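(* For every integer $k\geqslant 4$, the pairs $(3;1),\ (k;\tfrac{5}{6}),\ (k;\tfrac{5}{6})$ form admissible exponents.
   Context: Write $e(\alpha)=e^{2\pi i\alpha}$ and $f_k(\alpha,X)=\sum_{X<x\leqslant 2X}e(\alpha x^k)$, the sum being over integers $x$. Let $k_i\in\mathbb{N}$, $0<\lambda_i\leqslant 1$ $(i=1,\dots,s)$ and $P_i=N^{\lambda_i/k_i}$. The pairs $(k_1;\lambda_1),\dots,(k_s;\lambda_s)$ are said to form admissible exponents if for every $\varepsilon>0$ $$\int_0^1\big|f_{k_1}(\alpha,P_1)\cdots f_{k_s}(\alpha,P_s)\big|^2\,\mathrm{d}\alpha\ll P_1P_2\cdots P_sN^{\varepsilon},$$ where the implied constant does not depend on $N$ (it may depend on $\varepsilon$ and on the $k_i,\lambda_i$). *)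

theory Defs
  imports "HOL-Analysis.Analysis"
begin

definition add_char :: "real \<Rightarrow> complex" where
  "add_char \<alpha> = exp (2 * of_real pi * \<i> * of_real \<alpha>)"

definition weyl_sum :: "nat \<Rightarrow> real \<Rightarrow> real \<Rightarrow> complex" where
  "weyl_sum k \<alpha> X =
     (\<Sum>x\<in>{x::int. X < of_int x \<and> of_int x \<le> 2 * X}. add_char (\<alpha> * of_int x ^ k))"

definition range_param :: "real \<Rightarrow> nat \<times> real \<Rightarrow> real" where
  "range_param N p = N powr (snd p / real (fst p))"

text \<open>
  The list holds the pairs \<open>(k\<^sub>1; \<lambda>\<^sub>1), \<dots>, (k\<^sub>s; \<lambda>\<^sub>s)\<close>. The parameter \<open>N\<close> is real;
  the bound \<open>N \<ge> 1\<close> makes the Vinogradov symbol uniform over all such \<open>N\<close>, not only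
  over sufficiently large ones.
\<close>

definition admissible_exponents :: "(nat \<times> real) list \<Rightarrow> bool" where
  "admissible_exponents ps \<longleftrightarrow>
     (\<forall>(k, l) \<in> set ps. 1 \<le> k \<and> 0 < l \<and> l \<le> 1) \<and>
     (\<forall>\<epsilon>>0. \<exists>C>0. \<forall>N\<ge>1.
        integral {0..1}
          (\<lambda>\<alpha>. (cmod (\<Prod>p\<leftarrow>ps. weyl_sum (fst p) \<alpha> (range_param N p)))\<^sup>2)
        \<le> C * (\<Prod>p\<leftarrow>ps. range_param N p) * N powr \<epsilon>)"

text \<open>
  The index set of the Weyl sum is finite and the integrand is continuous, so neither the sum
  nor the integral takes its default value \<open>0\<close>.
\<close>

lemma finite_weyl_range: "finite {x::int. X < of_int x \<and> of_int x \<le> 2 * (X::real)}"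
proof (rule finite_subset)
  show "{x::int. X < of_int x \<and> of_int x \<le> 2 * X} \<subseteq> {\<lfloor>X\<rfloor>..\<lfloor>2 * X\<rfloor>}"
    by (auto simp: le_floor_iff floor_le_iff)
qed simp

lemma continuous_on_weyl_sum: "continuous_on A (\<lambda>\<alpha>. weyl_sum k \<alpha> X)"
  unfolding weyl_sum_def add_char_def by (intro continuous_intros)

lemma integrable_weyl_product:
  "(\<lambda>\<alpha>. (cmod (\<Prod>p\<leftarrow>ps. weyl_sum (fst p) \<alpha> (range_param N p)))\<^sup>2) integrable_on {0..1}"
proof -
  have "continuous_on {0..1} (\<lambda>\<alpha>. \<Prod>p\<leftarrow>ps. weyl_sum (fst p) \<alpha> (range_param N p))"
    by (induction ps) (auto intro!: continuous_intros continuous_on_weyl_sum)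
  then show ?thesis
    by (intro integrable_continuous_interval continuous_intros)
qed

end

theory Submission
  imports Defs "HOL-Computational_Algebra.Primes"
begin

text \<open>
  Write \<open>X = N\<^bsup>1/3\<^esup>\<close> and \<open>P = N\<^bsup>5/(6k)\<^esup>\<close>. By orthogonality the mean value is the number of solutions of
  \<open>x\<^sup>3 + y\<^sup>k + z\<^sup>k = x'\<^sup>3 + y'\<^sup>k + z'\<^sup>k\<close> with \<open>x, x'\<close> in the dyadic range of \<open>X\<close> and the other
  variables in that of \<open>P\<close>, and about \<open>X P\<^sup>2\<close> solutions are permitted. The proof is elementary and
  goes back to an idea of Davenport; its only arithmetic input is the bound \<open>d(n) = O(n\<^sup>\<epsilon>)\<close> for
  the number of divisors. Factors \<open>N\<^sup>\<epsilon>\<close> are ignored in what follows.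

  The equation \<open>y\<^sup>k + z\<^sup>k = y'\<^sup>k + z'\<^sup>k\<close> has about \<open>P\<^sup>2\<close> solutions: given \<open>z\<close> and \<open>z' \<noteq> z\<close>, the
  difference \<open>y - y'\<close> divides the nonzero number \<open>z'\<^sup>k - z\<^sup>k\<close> and determines \<open>y\<close> and \<open>y'\<close>
  (\<open>energy_two_powers_le\<close>). Hence the solutions with \<open>x = x'\<close> number about \<open>X P\<^sup>2\<close>.

  If \<open>x' = x + h\<close> with \<open>h \<noteq> 0\<close>, then \<open>\<bar>h\<bar> X\<^sup>2\<close> is at most a constant times \<open>P\<^sup>k = X\<^bsup>5/2\<^esup>\<close>,
  so \<open>\<bar>h\<bar>\<close> is at most of order \<open>X\<^bsup>1/2\<^esup>\<close>. The solutions are coincidences between the values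
  \<open>(h, u p)\<close> and \<open>(h, (x + h)\<^sup>3 - x\<^sup>3 + u q)\<close>, where \<open>u (y, z) = y\<^sup>k + z\<^sup>k\<close>. By Cauchy's inequality
  (\<open>card_coincidences_square_le\<close>) their number is at most the geometric mean of the numbers of
  coincidences of either family with itself. The first family contributes \<open>X\<^bsup>1/2\<^esup> P\<^sup>2\<close>. For the
  second, the cubic terms cancel and the equation becomes
  \<open>3h(x\<^sub>1 - x\<^sub>2)(x\<^sub>1 + x\<^sub>2 + h) = u q - u p\<close>; when the right side is nonzero, the divisor bound leaves
  few \<open>h, x\<^sub>1, x\<^sub>2\<close> for each of the \<open>P\<^sup>4\<close> choices of \<open>p, q\<close>, and otherwise \<open>x\<^sub>1 = x\<^sub>2\<close>, which gives
  \<open>X\<^bsup>1/2\<^esup> X P\<^sup>2\<close> (\<open>energy_shifted_cubes_le\<close>). The square of the number of solutions is therefore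
  at most about \<open>X\<^bsup>1/2\<^esup> P\<^sup>2 (X\<^bsup>3/2\<^esup> P\<^sup>2 + P\<^sup>4) = X\<^sup>2 P\<^sup>4 + X\<^bsup>1/2\<^esup> P\<^sup>6\<close>. This is of order
  \<open>X\<^sup>2 P\<^sup>4\<close> because \<open>P\<^sup>2 \<le> X\<^bsup>3/2\<^esup>\<close>, and this last inequality is where \<open>k \<ge> 4\<close> enters.
\<close>

section \<open>Coincidences of values and the Cauchy inequality\<close>

text \<open>
  The name is that of additive combinatorics, where the additive energy of \<open>A\<close> is the case of the
  map \<open>(a, b) \<longmapsto> a + b\<close> on \<open>A \<times> A\<close>.
\<close>

definition energy :: "('a \<Rightarrow> 'b) \<Rightarrow> 'a set \<Rightarrow> nat" where
  "energy f S = card {(s, t). s \<in> S \<and> t \<in> S \<and> f s = f t}"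

lemma energy_eq_sum_squares:
  assumes "finite S" "finite V" "f ` S \<subseteq> V"
  shows "energy f S = (\<Sum>v\<in>V. (card {s \<in> S. f s = v})\<^sup>2)"
proof -
  have "{(s, t). s \<in> S \<and> t \<in> S \<and> f s = f t}
      = (\<Union>v\<in>V. {s \<in> S. f s = v} \<times> {t \<in> S. f t = v})"
    using assms(3) by auto
  then have "energy f S = card (\<Union>v\<in>V. {s \<in> S. f s = v} \<times> {t \<in> S. f t = v})"
    by (simp add: energy_def)
  also have "\<dots> = (\<Sum>v\<in>V. card ({s \<in> S. f s = v} \<times> {t \<in> S. f t = v}))"
    using assms by (intro card_UN_disjoint) auto
  finally show ?thesis
    by (simp add: card_cartesian_product power2_eq_square)
qed

text \<open>
  If \<open>r(v)\<close> and \<open>r'(v)\<close> are the numbers of times that \<open>f\<close> and \<open>g\<close> take the value \<open>v\<close>, then the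
  coincidences number \<open>\<Sum> r(v) r'(v)\<close>, while the energies are \<open>\<Sum> r(v)\<^sup>2\<close> and \<open>\<Sum> r'(v)\<^sup>2\<close>.
\<close>

lemma card_coincidences_square_le:
  assumes "finite S" "finite T"
  shows "(card {(s, t). s \<in> S \<and> t \<in> T \<and> f s = g t})\<^sup>2 \<le> energy f S * energy g T"
proof -
  define V where "V = f ` S \<union> g ` T"
  have [simp]: "finite V"
    using assms by (simp add: V_def)
  have "{(s, t). s \<in> S \<and> t \<in> T \<and> f s = g t}
      = (\<Union>v\<in>V. {s \<in> S. f s = v} \<times> {t \<in> T. g t = v})"
    by (auto simp: V_def)
  then have "card {(s, t). s \<in> S \<and> t \<in> T \<and> f s = g t}
      = card (\<Union>v\<in>V. {s \<in> S. f s = v} \<times> {t \<in> T. g t = v})"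
    by simp
  also have "\<dots> = (\<Sum>v\<in>V. card ({s \<in> S. f s = v} \<times> {t \<in> T. g t = v}))"
    using assms by (intro card_UN_disjoint) auto
  finally have eq: "card {(s, t). s \<in> S \<and> t \<in> T \<and> f s = g t}
      = (\<Sum>v\<in>V. card {s \<in> S. f s = v} * card {t \<in> T. g t = v})"
    by (simp add: card_cartesian_product)
  have "real ((card {(s, t). s \<in> S \<and> t \<in> T \<and> f s = g t})\<^sup>2)
      \<le> real (energy f S * energy g T)"
    using Cauchy_Schwarz_ineq_sum[of "\<lambda>v. real (card {s \<in> S. f s = v})"
        "\<lambda>v. real (card {t \<in> T. g t = v})" V] assms
    unfolding eq by (simp add: energy_eq_sum_squares[where V = V] V_def)
  then show ?thesis
    by (simp only: of_nat_le_iff)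
qed

lemma card_le_fibres:
  assumes "finite S" "finite I" "f ` S \<subseteq> I"
    and "\<And>i. i \<in> I \<Longrightarrow> card {s \<in> S. f s = i} \<le> m"
  shows "card S \<le> card I * m"
proof -
  have "card S = (\<Sum>i\<in>I. card {s \<in> S. f s = i})"
    using sum.group[OF assms(1-3), of "\<lambda>_. 1 :: nat"] by simp
  also have "\<dots> \<le> card I * m"
    using sum_bounded_above[of I "\<lambda>i. card {s \<in> S. f s = i}" m] assms(4) by simp
  finally show ?thesis .
qed

section \<open>Orthogonality\<close>

text \<open>
  Parseval's identity. The proof stays in the reals: the squared modulus expands into the cosines
  of \<open>2\<pi>(f s - f t)\<alpha>\<close>, whose integrals over a full period are \<open>0\<close> or \<open>1\<close>.
\<close>

lemma integral_cmod_exponential_sum_squared: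
  fixes f :: "'a \<Rightarrow> int"
  assumes "finite S"
  shows "integral {0..1} (\<lambda>\<alpha>. (cmod (\<Sum>s\<in>S. add_char (\<alpha> * of_int (f s))))\<^sup>2) = energy f S"
proof -
  have cos_int: "((\<lambda>\<alpha>. cos (2 * pi * of_int n * \<alpha>)) has_integral (if n = 0 then 1 else 0)) {0..1}"
    for n :: int
  proof (cases "n = 0")
    case True
    then show ?thesis using has_integral_const_real[of "1::real" 0 1] by simp
  next
    case False
    have "((\<lambda>\<alpha>. cos (2 * pi * of_int n * \<alpha>)) has_integral
        (sin (2 * pi * of_int n * 1) / (2 * pi * of_int n) - sin (2 * pi * of_int n * 0) / (2 * pi * of_int n))) {0..1}"
      using False
      by (intro fundamental_theorem_of_calculus)
         (auto intro!: derivative_eq_intros simp flip: has_real_derivative_iff_has_vector_derivative)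
    then show ?thesis using False by (simp add: sin_int_2pin)
  qed
  have expand: "(cmod (\<Sum>s\<in>S. add_char (\<alpha> * of_int (f s))))\<^sup>2
      = (\<Sum>s\<in>S. \<Sum>t\<in>S. cos (2 * pi * of_int (f s - f t) * \<alpha>))" for \<alpha>
  proof -
    have "add_char x = cis (2 * pi * x)" for x
      by (simp add: add_char_def cis_conv_exp mult_ac)
    then have "(cmod (\<Sum>s\<in>S. add_char (\<alpha> * of_int (f s))))\<^sup>2
        = (\<Sum>s\<in>S. cos (2 * pi * (\<alpha> * f s)))\<^sup>2 + (\<Sum>s\<in>S. sin (2 * pi * (\<alpha> * f s)))\<^sup>2"
      by (simp add: cmod_power2)
    also have "\<dots> = (\<Sum>s\<in>S. \<Sum>t\<in>S. cos (2 * pi * (\<alpha> * f s) - 2 * pi * (\<alpha> * f t)))"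
      by (simp add: power2_eq_square sum_product cos_diff sum.distrib)
    finally show ?thesis
      by (simp add: algebra_simps)
  qed
  have "((\<lambda>\<alpha>. \<Sum>s\<in>S. \<Sum>t\<in>S. cos (2 * pi * of_int (f s - f t) * \<alpha>)) has_integral
      (\<Sum>s\<in>S. \<Sum>t\<in>S. if f s - f t = 0 then 1 else 0)) {0..1}"
    using assms by (intro has_integral_sum cos_int)
  moreover have "(\<Sum>s\<in>S. \<Sum>t\<in>S. if f s - f t = 0 then 1 else 0) = real (energy f S)"
  proof -
    have "{(s, t). s \<in> S \<and> t \<in> S \<and> f s = f t} = (SIGMA s:S. {t \<in> S. f s = f t})"
      by auto
    then show ?thesis using assms
      by (simp add: energy_def sum.If_cases Int_def)
  qed
  ultimately show ?thesis
    unfolding expand by (simp add: integral_unique)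
qed

section \<open>The divisor bound\<close>

lemma card_divisors_mult_le:
  fixes m n :: nat
  assumes "m > 0" "n > 0"
  shows "card {d. d dvd m * n} \<le> card {d. d dvd m} * card {d. d dvd n}"
proof -
  have "{d. d dvd m * n} \<subseteq> (\<lambda>(a, b). a * b) ` ({d. d dvd m} \<times> {d. d dvd n})"
  proof
    fix d assume "d \<in> {d. d dvd m * n}"
    then obtain a b where "d = a * b" "a dvd m" "b dvd n"
      using division_decomp[of d m n] by blast
    then show "d \<in> (\<lambda>(a, b). a * b) ` ({d. d dvd m} \<times> {d. d dvd n})"
      by (auto intro: image_eqI[of _ _ "(a, b)"])
  qed
  then have "card {d. d dvd m * n} \<le> card ({d. d dvd m} \<times> {d. d dvd n})"
    using assms by (intro surj_card_le) (auto intro: finite_divisors_nat)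
  then show ?thesis by (simp add: card_cartesian_product)
qed

lemma card_divisors_prime_power:
  fixes p :: nat
  assumes "prime p"
  shows "card {d. d dvd p ^ a} = a + 1"
proof -
  have "{d. d dvd p ^ a} = (\<lambda>i. p ^ i) ` {..a}"
    using assms by (auto simp: divides_primepow_nat)
  moreover have "inj_on (\<lambda>i. p ^ i) {..a}"
    using prime_gt_1_nat[OF assms] by (auto intro!: inj_onI simp: power_inject_exp)
  ultimately show ?thesis by (simp add: card_image)
qed

text \<open>
  The factor \<open>a + 1\<close> that an exact prime power \<open>p\<^sup>a\<close> contributes to the number of divisors is
  compared with \<open>p\<^bsup>a\<epsilon>\<^esup>\<close>. If \<open>p\<^sup>\<epsilon> \<ge> 2\<close>, then \<open>a + 1 \<le> 2\<^sup>a \<le> p\<^bsup>a\<epsilon>\<^esup>\<close>. For each of the finitely many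
  smaller primes a constant factor \<open>K\<close> is lost, because \<open>p\<^bsup>a\<epsilon>\<^esup>\<close> is at least the linear function
  \<open>1 + a\<epsilon> ln 2\<close> of \<open>a\<close>.
\<close>

lemma divisor_bound_nat:
  fixes \<epsilon> :: real
  assumes "\<epsilon> > 0"
  shows "\<exists>C\<ge>1. \<forall>n::nat>0. card {d. d dvd n} \<le> C * real n powr \<epsilon>"
proof -
  define L where "L = 2 powr (1 / \<epsilon>)"
  define S where "S = {p::nat. prime p \<and> real p < L}"
  define K where "K = max 1 (1 / (\<epsilon> * ln 2))"
  have "S \<subseteq> {..nat \<lceil>L\<rceil>}"
    unfolding S_def by (auto; linarith)
  then have finS: "finite S" by (rule finite_subset) simp
  have K1: "K \<ge> 1" by (simp add: K_def)
  have large: "real (a + 1) \<le> real (p ^ a) powr \<epsilon>" if "prime p" "p \<notin> S" for p a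
  proof -
    have "L \<le> real p" using that by (simp add: S_def)
    then have "L powr \<epsilon> \<le> real p powr \<epsilon>"
      using assms by (intro powr_mono2) (auto simp: L_def)
    then have "2 \<le> real p powr \<epsilon>"
      using assms by (simp add: L_def powr_powr)
    then have "2 ^ a \<le> (real p powr \<epsilon>) ^ a"
      by (intro power_mono) auto
    also have "\<dots> = real (p ^ a) powr \<epsilon>"
      using prime_gt_0_nat[OF that(1)] by (simp add: powr_power powr_powr flip: powr_realpow) (simp add: mult.commute)
    finally have "2 ^ a \<le> real (p ^ a) powr \<epsilon>" .
    moreover have "real (a + 1) \<le> 2 ^ a"
      using less_exp[of a] by (metis Suc_eq_plus1 Suc_leI of_nat_le_iff of_nat_numeral of_nat_power)
    ultimately show ?thesis by linarith
  qed
  have small: "real (a + 1) \<le> K * real (p ^ a) powr \<epsilon>" if "prime p" for p a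
  proof -
    have "1 \<le> K * (\<epsilon> * ln 2)"
      using assms by (simp add: K_def max_def field_simps)
    then have "real a * 1 \<le> real a * (K * (\<epsilon> * ln 2))"
      by (intro mult_left_mono) auto
    then have "real (a + 1) \<le> K * (1 + real a * \<epsilon> * ln 2)"
      using K1 by (simp add: algebra_simps)
    also have "\<dots> \<le> K * exp (real a * \<epsilon> * ln 2)"
      using K1 by (intro mult_left_mono exp_ge_add_one_self) auto
    also have "exp (real a * \<epsilon> * ln 2) = real (2 ^ a) powr \<epsilon>"
      by (simp add: powr_def ln_realpow mult_ac)
    also have "K * \<dots> \<le> K * real (p ^ a) powr \<epsilon>"
    proof -
      have "(2::nat) ^ a \<le> p ^ a"
        using prime_ge_2_nat[OF that] by (intro power_mono) auto
      then show ?thesis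
        using K1 assms by (intro mult_left_mono powr_mono2) (auto simp only: of_nat_le_iff of_nat_0_le_iff)
    qed
    finally show ?thesis .
  qed
  have bound: "real (card {d. d dvd n}) \<le> K ^ card (prime_factors n \<inter> S) * real n powr \<epsilon>"
    if "n > 0" for n
    using that
  proof (induction n rule: less_induct)
    case (less n)
    show ?case
    proof (cases "n = 1")
      case True
      then show ?thesis by simp
    next
      case False
      then obtain p where p: "prime p" "p dvd n"
        using prime_factor_nat by blast
      obtain m where m: "n = p ^ multiplicity p n * m" "\<not> p dvd m"
        using multiplicity_decompose'[of n p] less.prems p by (metis not_gr_zero not_prime_unit)
      define a where "a = multiplicity p n"
      have n: "n = p ^ a * m" using m a_def by simp
      have m0: "m > 0" using less.prems n by (auto intro: Nat.gr0I)
      have "a \<noteq> 0" using m p n by (auto intro: Nat.gr0I)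
      have p1: "p > 1" using p prime_gt_1_nat by blast
      then have "p ^ a > 1" using \<open>a \<noteq> 0\<close> one_less_power by blast
      then have "m < n" using n m0 by simp
      have pf: "prime_factors n = insert p (prime_factors m)"
        using p m0 p1 \<open>a \<noteq> 0\<close>
        by (simp add: n prime_factors_product prime_factorization_prime_power)
      have step: "real (a + 1) * K ^ card (prime_factors m \<inter> S)
          \<le> K ^ card (prime_factors n \<inter> S) * real (p ^ a) powr \<epsilon>"
      proof (cases "p \<in> S")
        case True
        have "p \<notin> prime_factors m" using m(2) by auto
        then have "card (prime_factors n \<inter> S) = Suc (card (prime_factors m \<inter> S))"
          using True by (simp add: pf)
        then show ?thesis
          using mult_right_mono[OF small[OF p(1), of a], of "K ^ card (prime_factors m \<inter> S)"] K1
          by (simp add: mult_ac)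
      next
        case False
        then show ?thesis
          using mult_right_mono[OF large[OF p(1), of a], of "K ^ card (prime_factors m \<inter> S)"] K1
          by (simp add: pf mult_ac)
      qed
      have "card {d. d dvd n} \<le> (a + 1) * card {d. d dvd m}"
        using card_divisors_mult_le[of "p ^ a" m] card_divisors_prime_power[OF p(1), of a] p1 m0
        by (simp add: n)
      then have "real (card {d. d dvd n}) \<le> real ((a + 1) * card {d. d dvd m})"
        by (simp only: of_nat_le_iff)
      also have "\<dots> \<le> real (a + 1) * (K ^ card (prime_factors m \<inter> S) * real m powr \<epsilon>)"
        unfolding of_nat_mult using less.IH[OF \<open>m < n\<close> m0] by (intro mult_left_mono) auto
      also have "\<dots> \<le> K ^ card (prime_factors n \<inter> S) * real (p ^ a) powr \<epsilon> * real m powr \<epsilon>"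
        using mult_right_mono[OF step, of "real m powr \<epsilon>"] by (simp add: mult_ac)
      also have "\<dots> = K ^ card (prime_factors n \<inter> S) * real n powr \<epsilon>"
        by (simp add: n powr_mult)
      finally show ?thesis .
    qed
  qed
  show ?thesis
  proof (intro exI[of _ "K ^ card S"] conjI allI impI)
    show "1 \<le> K ^ card S" using K1 by simp
    fix n :: nat assume "n > 0"
    have "K ^ card (prime_factors n \<inter> S) \<le> K ^ card S"
      using K1 finS by (intro power_increasing card_mono) auto
    then show "real (card {d. d dvd n}) \<le> K ^ card S * real n powr \<epsilon>"
      using bound[OF \<open>n > 0\<close>] by (meson mult_right_mono order_trans powr_ge_zero)
  qed
qed

text \<open>
  Counting divisors of both signs lets the later arguments assign to a solution a signed difference
  without distinguishing the order of the two variables.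
\<close>

lemma divisor_bound_int:
  fixes \<epsilon> :: real
  assumes "\<epsilon> > 0"
  shows "\<exists>C\<ge>1. \<forall>n::int. n \<noteq> 0 \<longrightarrow> card {d. d dvd n} \<le> C * \<bar>real_of_int n\<bar> powr \<epsilon>"
proof -
  obtain C where C: "C \<ge> 1" "\<And>n::nat. n > 0 \<Longrightarrow> card {d. d dvd n} \<le> C * real n powr \<epsilon>"
    using divisor_bound_nat[OF assms] by blast
  have "real (card {d. d dvd n}) \<le> (2 * C) * \<bar>real_of_int n\<bar> powr \<epsilon>" if "n \<noteq> 0" for n :: int
  proof -
    let ?D = "{d. d dvd nat \<bar>n\<bar>}"
    have fin: "finite ?D" using that by (intro finite_divisors_nat) auto
    have "{d. d dvd n} \<subseteq> int ` ?D \<union> (\<lambda>d. - int d) ` ?D"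
    proof
      fix d assume "d \<in> {d. d dvd n}"
      then have "nat \<bar>d\<bar> \<in> ?D" by (simp add: nat_dvd_iff)
      moreover have "d = int (nat \<bar>d\<bar>) \<or> d = - int (nat \<bar>d\<bar>)" by auto
      ultimately show "d \<in> int ` ?D \<union> (\<lambda>d. - int d) ` ?D" by blast
    qed
    then have "card {d. d dvd n} \<le> card (int ` ?D \<union> (\<lambda>d. - int d) ` ?D)"
      using fin by (intro card_mono) auto
    also have "\<dots> \<le> card ?D + card ?D"
      by (intro order_trans[OF card_Un_le] add_mono card_image_le fin)
    finally have "real (card {d. d dvd n}) \<le> 2 * real (card ?D)" by simp
    also have "\<dots> \<le> 2 * (C * real (nat \<bar>n\<bar>) powr \<epsilon>)"
      using C(2)[of "nat \<bar>n\<bar>"] that by simp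
    finally show ?thesis by (simp add: mult_ac)
  qed
  moreover have "2 * C \<ge> 1" using C(1) by simp
  ultimately show ?thesis by blast
qed

section \<open>Coincidences among sums of two powers\<close>

lemma power_gap_strict_mono:
  fixes b c d :: int
  assumes "0 < b" "b < c" "0 < d" "2 \<le> k"
  shows "(b + d) ^ k - b ^ k < (c + d) ^ k - c ^ k"
  using assms(4)
proof (induction k rule: nat_induct_at_least)
  case base
  have "b * d < c * d" using assms by simp
  then show ?case by (simp add: power2_eq_square algebra_simps)
next
  case (Suc k)
  have gap: "(y + d) ^ Suc k - y ^ Suc k = (y + d) * ((y + d) ^ k - y ^ k) + d * y ^ k" for y
    by (simp add: algebra_simps)
  have "b ^ k \<le> (b + d) ^ k" "b ^ k \<le> c ^ k"
    using assms by (auto intro!: power_mono)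
  then have "(b + d) * ((b + d) ^ k - b ^ k) \<le> (b + d) * ((c + d) ^ k - c ^ k)"
    and "(b + d) * ((c + d) ^ k - c ^ k) < (c + d) * ((c + d) ^ k - c ^ k)"
    and "d * b ^ k \<le> d * c ^ k"
    using assms Suc.IH by (auto intro!: mult_left_mono mult_strict_right_mono)
  then show ?case unfolding gap by linarith
qed

text \<open>
  Among the pairs of positive integers with a given nonzero difference of \<open>k\<close>-th powers, a pair is
  determined by its difference, which divides that number. This is why a nonzero difference of \<open>k\<close>-th powers has few representations.
\<close>

lemma power_diff_determines_pair:
  fixes a b c e :: int
  assumes "0 < a" "0 < b" "0 < c" "0 < e" "2 \<le> k"
    and "a \<noteq> b" "a - b = c - e" "a ^ k - b ^ k = c ^ k - e ^ k"
  shows "a = c \<and> b = e"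
proof -
  have *: "y = z" if "0 < d" "0 < y" "0 < z" "(y + d) ^ k - y ^ k = (z + d) ^ k - z ^ k"
    for y z d :: int
    using power_gap_strict_mono[of y z d k] power_gap_strict_mono[of z y d k] that assms(5)
    by (cases y z rule: linorder_cases) auto
  define d where "d = a - b"
  have a: "a = b + d" and c: "c = e + d" using assms(7) by (simp_all add: d_def)
  show ?thesis
  proof (cases "d > 0")
    case True
    then have "b = e" using assms(2,4,8) unfolding a c by (rule *[of d b e])
    then show ?thesis using a c by simp
  next
    case False
    then have "- d > 0" using assms(6) by (simp add: d_def)
    moreover have "(a + - d) ^ k - a ^ k = (c + - d) ^ k - c ^ k"
      using assms(8) a c by simp
    ultimately have "a = c" using assms(1,3) *[of "- d" a c] by blast
    then show ?thesis using a c by simp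
  qed
qed

text \<open>
  The coincidences \<open>x\<^sup>k + y\<^sup>k = x'\<^sup>k + y'\<^sup>k\<close> with \<open>y = y'\<close> are trivial; each pair \<open>y \<noteq> y'\<close> admits at most
  one pair \<open>(x, x')\<close> for every divisor \<open>x - x'\<close> of \<open>y'\<^sup>k - y\<^sup>k\<close>.
\<close>

lemma energy_two_powers_le:
  fixes B :: "int set"
  assumes "finite B" "\<And>b. b \<in> B \<Longrightarrow> 0 < b" "2 \<le> k"
    and D: "\<And>a b. a \<in> B \<Longrightarrow> b \<in> B \<Longrightarrow> a \<noteq> b \<Longrightarrow> card {d. d dvd a ^ k - b ^ k} \<le> D"
  shows "energy (\<lambda>(x, y). x ^ k + y ^ k) (B \<times> B) \<le> (card B)\<^sup>2 * (1 + D)"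
proof -
  define E where "E = {(s, t). s \<in> B \<times> B \<and> t \<in> B \<times> B \<and>
    (\<lambda>(x, y). x ^ k + y ^ k) s = (\<lambda>(x, y). x ^ k + y ^ k) t}"
  define E0 where "E0 = {z \<in> E. snd (fst z) = snd (snd z)}"
  define E1 where "E1 = {z \<in> E. snd (fst z) \<noteq> snd (snd z)}"
  have finE: "finite E"
    by (rule finite_subset[of _ "(B \<times> B) \<times> (B \<times> B)"]) (use assms in \<open>auto simp: E_def\<close>)
  have pow_inj: "x ^ k = y ^ k \<Longrightarrow> x = y" if "x \<in> B" "y \<in> B" for x y
    using that assms(2)[of x] assms(2)[of y] assms(3) by (simp add: power_eq_iff_eq_base)
  have "E0 \<subseteq> (\<lambda>s. (s, s)) ` (B \<times> B)"
    using pow_inj by (auto simp: E0_def E_def image_iff)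
  then have "card E0 \<le> card (B \<times> B)"
    using assms by (intro surj_card_le) auto
  moreover have "card E1 \<le> card (B \<times> B) * D"
  proof (rule card_le_fibres[of _ _ "\<lambda>z. (snd (fst z), snd (snd z))"])
    show "finite E1" using finE by (simp add: E1_def)
    show "finite (B \<times> B)" using assms by simp
    show "(\<lambda>z. (snd (fst z), snd (snd z))) ` E1 \<subseteq> B \<times> B"
      by (auto simp: E1_def E_def)
    fix i assume i: "i \<in> B \<times> B"
    obtain y y' where yy: "i = (y, y')" by (cases i)
    let ?F = "{z \<in> E1. (snd (fst z), snd (snd z)) = i}"
    show "card ?F \<le> D"
    proof (cases "y = y'")
      case True
      then have "?F = {}" by (auto simp: E1_def yy)
      then show ?thesis by (metis card.empty le0)
    next
      case False
      then have ne: "y' ^ k - y ^ k \<noteq> 0" using pow_inj i yy by auto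
      have "card ?F \<le> card {d. d dvd y' ^ k - y ^ k}"
      proof (rule card_inj_on_le[of "\<lambda>z. fst (fst z) - fst (snd z)"])
        show "inj_on (\<lambda>z. fst (fst z) - fst (snd z)) ?F"
        proof (rule inj_onI)
          fix z w assume z: "z \<in> ?F" and w: "w \<in> ?F"
            and eq: "fst (fst z) - fst (snd z) = fst (fst w) - fst (snd w)"
          obtain a b where z': "z = ((a, y), (b, y'))" "a \<in> B" "b \<in> B" "a ^ k + y ^ k = b ^ k + y' ^ k"
            using z by (auto simp: E1_def E_def yy)
          obtain c e where w': "w = ((c, y), (e, y'))" "c \<in> B" "e \<in> B" "c ^ k + y ^ k = e ^ k + y' ^ k"
            using w by (auto simp: E1_def E_def yy)
          have "a \<noteq> b" using z'(4) ne by auto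
          then have "a = c \<and> b = e"
            using eq z' w' assms(2,3) by (intro power_diff_determines_pair[of a b c e k]) auto
          then show "z = w" using z' w' by simp
        qed
        show "(\<lambda>z. fst (fst z) - fst (snd z)) ` ?F \<subseteq> {d. d dvd y' ^ k - y ^ k}"
        proof
          fix v assume "v \<in> (\<lambda>z. fst (fst z) - fst (snd z)) ` ?F"
          then obtain a b where "((a, y), (b, y')) \<in> E1" and v: "v = a - b"
            by (auto simp: yy)
          then have "y' ^ k - y ^ k = a ^ k - b ^ k"
            by (simp add: E1_def E_def)
          then show "v \<in> {d. d dvd y' ^ k - y ^ k}"
            by (simp add: v power_diff_sumr2)
        qed
        show "finite {d. d dvd y' ^ k - y ^ k}" using ne by (rule finite_divisors_int)
      qed
      also have "\<dots> \<le> D" using D[of y' y] False i yy by auto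
      finally show ?thesis .
    qed
  qed
  moreover have "card E \<le> card E0 + card E1"
  proof -
    have "E = E0 \<union> E1" by (auto simp: E0_def E1_def)
    then show ?thesis by (metis card_Un_le)
  qed
  ultimately show ?thesis
    by (simp add: energy_def E_def[symmetric] card_cartesian_product power2_eq_square algebra_simps)
qed

section \<open>Differencing the cube\<close>

text \<open>
  Subtracting two values with the same \<open>h\<close> removes the cubes and leaves
  \<open>3h(x - y)(x + y + h) = u q - u p\<close>. Keeping \<open>h\<close> as part of the value is essential: \<open>h\<close> itself is
  a divisor of \<open>u q - u p\<close>, so the term \<open>(card Q)\<^sup>2 D\<^sup>2\<close> carries no factor \<open>card H\<close>, as it would if
  each \<open>h\<close> were treated separately. Requiring \<open>x + h \<in> A\<close> makes \<open>x + y + h\<close> positive, so that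
  \<open>u p = u q\<close> forces \<open>x = y\<close>.
\<close>

lemma energy_shifted_cubes_le:
  fixes A H :: "int set" and u :: "'p \<Rightarrow> int"
  assumes fin: "finite A" "finite Q" "finite H"
    and pos: "\<And>x. x \<in> A \<Longrightarrow> 0 < x" and "0 \<notin> H"
    and D: "\<And>p q. p \<in> Q \<Longrightarrow> q \<in> Q \<Longrightarrow> u p \<noteq> u q \<Longrightarrow> card {d. d dvd u p - u q} \<le> D"
  defines "T \<equiv> {(h, x, p). h \<in> H \<and> x \<in> A \<and> x + h \<in> A \<and> p \<in> Q}"
  shows "energy (\<lambda>(h, x, p). (h, (x + h) ^ 3 - x ^ 3 + u p)) T
    \<le> card H * card A * energy u Q + (card Q)\<^sup>2 * D\<^sup>2"
proof -
  define G where "G = {(s, t). s \<in> T \<and> t \<in> T \<and>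
    (\<lambda>(h, x, p). (h, (x + h) ^ 3 - x ^ 3 + u p)) s = (\<lambda>(h, x, p). (h, (x + h) ^ 3 - x ^ 3 + u p)) t}"
  define key where "key = (\<lambda>z :: (int \<times> int \<times> 'p) \<times> (int \<times> int \<times> 'p). (snd (snd (fst z)), snd (snd (snd z))))"
  define G0 where "G0 = {z \<in> G. u (fst (key z)) = u (snd (key z))}"
  define G1 where "G1 = {z \<in> G. u (fst (key z)) \<noteq> u (snd (key z))}"
  define U where "U = {(p, q). p \<in> Q \<and> q \<in> Q \<and> u p = u q}"
  have finT: "finite T"
    by (rule finite_subset[of _ "H \<times> A \<times> Q"]) (use fin in \<open>auto simp: T_def\<close>)
  have finG: "finite G"
    by (rule finite_subset[of _ "T \<times> T"]) (use finT in \<open>auto simp: G_def\<close>)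
  have finU: "finite U"
    by (rule finite_subset[of _ "Q \<times> Q"]) (use fin in \<open>auto simp: U_def\<close>)
  have diff: "3 * h * (x - y) * (x + y + h) = u q - u p"
    if "((h, x, p), (h', y, q)) \<in> G" for h h' x y p q
  proof -
    have "h' = h" "(x + h) ^ 3 - x ^ 3 + u p = (y + h) ^ 3 - y ^ 3 + u q"
      using that by (auto simp: G_def)
    then show ?thesis by (simp add: power3_eq_cube algebra_simps)
  qed
  have "G0 \<subseteq> (\<lambda>(h, x, p, q). ((h, x, p), (h, x, q))) ` (H \<times> A \<times> U)"
  proof
    fix z assume z: "z \<in> G0"
    obtain h x p h' y q where zz: "z = ((h, x, p), (h', y, q))" by (metis prod.collapse)
    have zG: "((h, x, p), (h', y, q)) \<in> G" "u p = u q" using z by (auto simp: G0_def key_def zz)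
    have mem: "h' = h" "h \<in> H" "x \<in> A" "y \<in> A" "y + h \<in> A" "p \<in> Q" "q \<in> Q"
      using zG by (auto simp: G_def T_def)
    have "x + (y + h) > 0" using pos mem by (simp add: add_pos_pos)
    then have "x = y" using diff[OF zG(1)] zG(2) mem \<open>0 \<notin> H\<close> by auto
    then show "z \<in> (\<lambda>(h, x, p, q). ((h, x, p), (h, x, q))) ` (H \<times> A \<times> U)"
      using mem zG(2) by (auto simp: zz U_def image_iff)
  qed
  then have "card G0 \<le> card (H \<times> A \<times> U)"
    using fin finU by (intro surj_card_le) auto
  moreover have "card G1 \<le> card (Q \<times> Q) * D\<^sup>2"
  proof (rule card_le_fibres[of _ _ key])
    show "finite G1" using finG by (simp add: G1_def)
    show "finite (Q \<times> Q)" using fin by simp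
    show "key ` G1 \<subseteq> Q \<times> Q" by (auto simp: G1_def G_def T_def key_def)
    fix i assume i: "i \<in> Q \<times> Q"
    obtain p q where pq: "i = (p, q)" by (cases i)
    let ?F = "{z \<in> G1. key z = i}"
    show "card ?F \<le> D\<^sup>2"
    proof (cases "u p = u q")
      case True
      then have "?F = {}" by (auto simp: G1_def pq)
      then show ?thesis by (metis card.empty le0)
    next
      case False
      let ?V = "{d. d dvd u q - u p}"
      have finV: "finite ?V" using False by (intro finite_divisors_int) auto
      have form: "\<exists>h x y. z = ((h, x, p), (h, y, q)) \<and> 3 * h * (x - y) * (x + y + h) = u q - u p"
        if "z \<in> ?F" for z
      proof -
        obtain h x p' h' y q' where zz: "z = ((h, x, p'), (h', y, q'))" by (metis prod.collapse)
        have "p' = p" "q' = q" "h' = h" "z \<in> G" using that by (auto simp: zz key_def pq G1_def G_def)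
        then show ?thesis using diff zz by auto
      qed
      \<comment> \<open>Both components divide \<open>u q - u p\<close>, and the remaining factor \<open>x + y + h\<close> recovers \<open>x\<close> and \<open>y\<close>.\<close>
      define \<delta> where "\<delta> = (\<lambda>z :: (int \<times> int \<times> 'p) \<times> (int \<times> int \<times> 'p).
        (fst (fst z), fst (snd (fst z)) - fst (snd (snd z))))"
      have "card ?F \<le> card (?V \<times> ?V)"
      proof (rule card_inj_on_le[of \<delta>])
        show "inj_on \<delta> ?F"
        proof (rule inj_onI)
          fix z w assume z: "z \<in> ?F" and w: "w \<in> ?F" and eq: "\<delta> z = \<delta> w"
          obtain h x y where z': "z = ((h, x, p), (h, y, q))" "3 * h * (x - y) * (x + y + h) = u q - u p"
            using form[OF z] by blast
          obtain h' x' y' where w': "w = ((h', x', p), (h', y', q))"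
              "3 * h' * (x' - y') * (x' + y' + h') = u q - u p"
            using form[OF w] by blast
          have h: "h' = h" "x - y = x' - y'" using eq z' w' by (auto simp: \<delta>_def)
          have "3 * h * (x - y) \<noteq> 0" using z'(2) False by (metis mult_zero_left right_minus_eq)
          moreover have "3 * h * (x - y) * (x + y + h) = 3 * h * (x - y) * (x' + y' + h)"
            using z'(2) w'(2) h by simp
          ultimately have "x + y + h = x' + y' + h" by (rule mult_left_cancel[THEN iffD1])
          then show "z = w" using h z' w' by simp
        qed
        show "\<delta> ` ?F \<subseteq> ?V \<times> ?V"
        proof
          fix v assume "v \<in> \<delta> ` ?F"
          then obtain z where z: "z \<in> ?F" "v = \<delta> z" by (rule imageE)
          from form[OF z(1)] obtain h x y where "z = ((h, x, p), (h, y, q))"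
              "3 * h * (x - y) * (x + y + h) = u q - u p"
            by blast
          with z(2) have "v = (h, x - y)" "3 * h * (x - y) * (x + y + h) = u q - u p"
            by (simp_all add: \<delta>_def)
          moreover have "h dvd 3 * h * (x - y) * (x + y + h)" "x - y dvd 3 * h * (x - y) * (x + y + h)"
            by simp_all
          ultimately show "v \<in> ?V \<times> ?V" by auto
        qed
        show "finite (?V \<times> ?V)" using finV by simp
      qed
      also have "\<dots> \<le> D\<^sup>2"
        using D[of q p] False i pq by (auto simp: card_cartesian_product power2_eq_square intro!: mult_le_mono)
      finally show ?thesis .
    qed
  qed
  moreover have "card G \<le> card G0 + card G1"
  proof -
    have "G = G0 \<union> G1" by (auto simp: G0_def G1_def)
    then show ?thesis by (metis card_Un_le)
  qed
  moreover have "energy (\<lambda>(h, x, p). (h, (x + h) ^ 3 - x ^ 3 + u p)) T = card G"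
    and "energy u Q = card U"
    unfolding energy_def G_def U_def by (rule refl)+
  ultimately show ?thesis
    by (simp add: card_cartesian_product power2_eq_square mult_ac)
qed

text \<open>
  The main estimate, for an arbitrary map \<open>u\<close>: the first term counts the coincidences with equal
  cubes, and \<open>M\<close> bounds the others, written as coincidences of \<open>(h, u p)\<close> with
  \<open>(h, (x + h)\<^sup>3 - x\<^sup>3 + u q)\<close>, where \<open>H\<close> contains all shifts \<open>h\<close> that can occur.
\<close>

lemma energy_cube_plus_le:
  fixes A H :: "int set" and u :: "'p \<Rightarrow> int"
  assumes fin: "finite A" "finite Q" "finite H"
    and pos: "\<And>x. x \<in> A \<Longrightarrow> 0 < x" and "0 \<notin> H"
    and D: "\<And>p q. p \<in> Q \<Longrightarrow> q \<in> Q \<Longrightarrow> u p \<noteq> u q \<Longrightarrow> card {d. d dvd u p - u q} \<le> D"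
    and H: "\<And>x y p q. x \<in> A \<Longrightarrow> y \<in> A \<Longrightarrow> p \<in> Q \<Longrightarrow> q \<in> Q \<Longrightarrow> x \<noteq> y
      \<Longrightarrow> x ^ 3 + u p = y ^ 3 + u q \<Longrightarrow> y - x \<in> H"
  shows "\<exists>M. energy (\<lambda>(x, p). x ^ 3 + u p) (A \<times> Q) \<le> card A * energy u Q + M \<and>
    M\<^sup>2 \<le> card H * energy u Q * (card H * card A * energy u Q + (card Q)\<^sup>2 * D\<^sup>2)"
proof -
  define T where "T = {(h, x, p). h \<in> H \<and> x \<in> A \<and> x + h \<in> A \<and> p \<in> Q}"
  define f where "f = (\<lambda>(h :: int, p). (h, u p))"
  define g where "g = (\<lambda>(h, x, p). (h, (x + h) ^ 3 - x ^ 3 + u p))"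
  define W where "W = {(s, t). s \<in> H \<times> Q \<and> t \<in> T \<and> f s = g t}"
  define U where "U = {(p, q). p \<in> Q \<and> q \<in> Q \<and> u p = u q}"
  have finT: "finite T"
    by (rule finite_subset[of _ "H \<times> A \<times> Q"]) (use fin in \<open>auto simp: T_def\<close>)
  have finW: "finite W"
    by (rule finite_subset[of _ "(H \<times> Q) \<times> T"]) (use fin finT in \<open>auto simp: W_def\<close>)
  have finU: "finite U"
    by (rule finite_subset[of _ "Q \<times> Q"]) (use fin in \<open>auto simp: U_def\<close>)
  have "{(s, t). s \<in> H \<times> Q \<and> t \<in> H \<times> Q \<and> f s = f t}
      \<subseteq> (\<lambda>(h, p, q). ((h, p), (h, q))) ` (H \<times> U)"
    by (auto simp: f_def U_def image_iff)
  then have "energy f (H \<times> Q) \<le> card (H \<times> U)"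
    unfolding energy_def using fin finU by (intro surj_card_le) auto
  then have f: "energy f (H \<times> Q) \<le> card H * energy u Q"
    by (simp add: card_cartesian_product energy_def U_def)
  have g: "energy g T \<le> card H * card A * energy u Q + (card Q)\<^sup>2 * D\<^sup>2"
    unfolding g_def T_def using assms(1-6) by (rule energy_shifted_cubes_le)
  have "(card W)\<^sup>2 \<le> energy f (H \<times> Q) * energy g T"
    unfolding W_def using fin finT by (intro card_coincidences_square_le) auto
  also have "\<dots> \<le> card H * energy u Q * (card H * card A * energy u Q + (card Q)\<^sup>2 * D\<^sup>2)"
    using f g by (rule mult_le_mono)
  finally have W: "(card W)\<^sup>2 \<le> card H * energy u Q * (card H * card A * energy u Q + (card Q)\<^sup>2 * D\<^sup>2)" .
  let ?E = "{(s, t). s \<in> A \<times> Q \<and> t \<in> A \<times> Q \<and> (\<lambda>(x, p). x ^ 3 + u p) s = (\<lambda>(x, p). x ^ 3 + u p) t}"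
  have "?E \<subseteq> (\<lambda>(x, p, q). ((x, p), (x, q))) ` (A \<times> U) \<union> (\<lambda>((h, p), (h', x, q)). ((x, p), (x + h, q))) ` W"
  proof
    fix z assume z: "z \<in> ?E"
    obtain x p y q where zz: "z = ((x, p), (y, q))" by (metis prod.collapse)
    have mem: "x \<in> A" "y \<in> A" "p \<in> Q" "q \<in> Q" "x ^ 3 + u p = y ^ 3 + u q" using z by (auto simp: zz)
    show "z \<in> (\<lambda>(x, p, q). ((x, p), (x, q))) ` (A \<times> U) \<union> (\<lambda>((h, p), (h', x, q)). ((x, p), (x + h, q))) ` W"
    proof (cases "x = y")
      case True
      then show ?thesis using mem by (auto simp: zz U_def image_iff)
    next
      case False
      then have "((y - x, p), (y - x, x, q)) \<in> W"
        using mem H[of x y p q] by (auto simp: W_def T_def f_def g_def)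
      then show ?thesis by (force simp: zz image_iff)
    qed
  qed
  then have "card ?E \<le> card ((\<lambda>(x, p, q). ((x, p), (x, q))) ` (A \<times> U)
      \<union> (\<lambda>((h, p), (h', x, q)). ((x, p), (x + h, q))) ` W)"
    using fin finU finW by (intro card_mono) auto
  also have "\<dots> \<le> card (A \<times> U) + card W"
    by (intro order_trans[OF card_Un_le] add_mono card_image_le finite_cartesian_product fin finU finW)
  finally have "energy (\<lambda>(x, p). x ^ 3 + u p) (A \<times> Q) \<le> card A * energy u Q + card W"
    by (simp add: energy_def U_def card_cartesian_product)
  then show ?thesis using W by blast
qed

section \<open>Weyl sums over dyadic ranges\<close>

definition dyadic :: "real \<Rightarrow> int set" where
  "dyadic X = {x. X < of_int x \<and> of_int x \<le> 2 * X}"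

lemma finite_dyadic: "finite (dyadic X)"
  unfolding dyadic_def by (rule finite_weyl_range)

lemma card_dyadic_le:
  fixes X :: real
  assumes "1 \<le> X"
  shows "card (dyadic X) \<le> 2 * X"
proof -
  have "dyadic X \<subseteq> {\<lfloor>X\<rfloor> + 1..\<lfloor>2 * X\<rfloor>}"
    unfolding dyadic_def by (auto simp: le_floor_iff; linarith)
  then have "card (dyadic X) \<le> card {\<lfloor>X\<rfloor> + 1..\<lfloor>2 * X\<rfloor>}"
    by (intro card_mono) auto
  then show ?thesis using assms by simp linarith
qed

lemma integral_weyl_product_eq_energy:
  "integral {0..1} (\<lambda>\<alpha>. (cmod (weyl_sum l \<alpha> X * (weyl_sum k \<alpha> P * weyl_sum k \<alpha> P)))\<^sup>2)
    = energy (\<lambda>(x, p). x ^ l + (\<lambda>(y, z). y ^ k + z ^ k) p) (dyadic X \<times> dyadic P \<times> dyadic P)"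
proof -
  have "weyl_sum l \<alpha> X * (weyl_sum k \<alpha> P * weyl_sum k \<alpha> P)
      = (\<Sum>s\<in>dyadic X \<times> dyadic P \<times> dyadic P.
          add_char (\<alpha> * of_int ((\<lambda>(x, p). x ^ l + (\<lambda>(y, z). y ^ k + z ^ k) p) s)))" for \<alpha>
  proof -
    have add: "add_char (x + y) = add_char x * add_char y" for x y
      by (simp add: add_char_def distrib_left exp_add)
    have "weyl_sum l \<alpha> X * (weyl_sum k \<alpha> P * weyl_sum k \<alpha> P)
        = (\<Sum>x\<in>dyadic X. \<Sum>y\<in>dyadic P. \<Sum>z\<in>dyadic P.
            add_char (\<alpha> * of_int (x ^ l + (y ^ k + z ^ k))))"
      unfolding weyl_sum_def dyadic_def[symmetric]
      by (simp only: sum_product) (simp add: sum_distrib_left add distrib_left)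
    then show ?thesis
      by (simp add: sum.cartesian_product case_prod_unfold)
  qed
  then show ?thesis
    by (simp add: integral_cmod_exponential_sum_squared finite_dyadic)
qed

section \<open>The size of the parameters\<close>

text \<open>
  \<open>y\<^sup>3 - x\<^sup>3\<close> is the product of \<open>y - x\<close> and \<open>x\<^sup>2 + xy + y\<^sup>2\<close>, and the latter exceeds \<open>X\<^sup>2\<close>.
\<close>

lemma cube_gap_bounds_shift:
  fixes x y :: int and X Y :: real
  assumes "x \<in> dyadic X" "y \<in> dyadic X" "0 < X"
    and "\<bar>of_int (y ^ 3 - x ^ 3)\<bar> \<le> X\<^sup>2 * Y"
  shows "\<bar>of_int (y - x)\<bar> \<le> Y"
proof -
  let ?x = "real_of_int x" and ?y = "real_of_int y"
  have xy: "X < ?x" "X < ?y" using assms by (auto simp: dyadic_def)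
  have "X * X \<le> ?x * ?x" "X * X \<le> ?y * ?y" "0 \<le> ?x * ?y"
    using xy assms(3) by (intro mult_mono mult_nonneg_nonneg; simp)+
  then have q: "X\<^sup>2 \<le> ?x * ?x + ?x * ?y + ?y * ?y"
    using zero_le_square[of ?y] unfolding power2_eq_square by linarith
  have "X\<^sup>2 * \<bar>?y - ?x\<bar> \<le> (?x * ?x + ?x * ?y + ?y * ?y) * \<bar>?y - ?x\<bar>"
    using q by (rule mult_right_mono) simp
  also have "\<dots> = \<bar>(?x * ?x + ?x * ?y + ?y * ?y) * (?y - ?x)\<bar>"
    using q by (simp add: abs_mult abs_of_nonneg[OF order_trans[OF zero_le_power2 q]])
  also have "(?x * ?x + ?x * ?y + ?y * ?y) * (?y - ?x) = of_int (y ^ 3 - x ^ 3)"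
    by (simp add: power3_eq_cube algebra_simps)
  finally have "X\<^sup>2 * \<bar>?y - ?x\<bar> \<le> X\<^sup>2 * Y" using assms(4) by linarith
  then show ?thesis using assms(3) by simp
qed

text \<open>
  This evaluates the bound of \<open>energy_cube_plus_le\<close> when \<open>a, b, h\<close> are the numbers of cubes, of
  \<open>k\<close>-th powers and of shifts, and \<open>R = X\<^bsup>1/2\<^esup>\<close>. The loss is expressed by \<open>D\<^sup>2\<close>, which absorbs the
  smaller powers of \<open>D\<close> since \<open>D \<ge> 1\<close>. The hypothesis on \<open>P\<close> makes the contribution \<open>R P\<^sup>6\<close> to \<open>M\<^sup>2\<close>
  no larger than \<open>X\<^sup>2 P\<^sup>4\<close>.
\<close>

lemma shifted_cube_bound_evaluation:
  fixes a b E h D M c X P R :: real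
  assumes nonneg: "0 \<le> a" "0 \<le> b" "0 \<le> E" "0 \<le> h" "0 < P" "0 < R"
    and "1 \<le> D" "1 \<le> c" and R: "R\<^sup>2 = X"
    and a: "a \<le> 2 * X" and b: "b \<le> 2 * P" and E: "E \<le> b\<^sup>2 * (1 + D)" and h: "h \<le> c * R"
    and P: "P\<^sup>2 \<le> X * R"
    and M: "M\<^sup>2 \<le> h * E * (h * a * E + (b\<^sup>2)\<^sup>2 * D\<^sup>2)"
  shows "a * E + M \<le> 32 * c * X * P\<^sup>2 * D\<^sup>2"
proof -
  have X: "0 < X" using R assms(6) by auto
  have b2: "b\<^sup>2 \<le> 4 * P\<^sup>2"
    using power_mono[OF b nonneg(2), of 2] by (simp add: power_mult_distrib)
  have "b\<^sup>2 * (1 + D) \<le> 4 * P\<^sup>2 * (2 * D)"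
    using b2 assms(7) by (intro mult_mono) auto
  then have E8: "E \<le> 8 * P\<^sup>2 * D" using E by linarith
  have D2: "D \<le> D\<^sup>2" using assms(7) by (simp add: power2_eq_square)
  have "a * E \<le> 2 * X * (8 * P\<^sup>2 * D)"
    using a E8 nonneg X by (intro mult_mono) auto
  also have "\<dots> \<le> 16 * X * P\<^sup>2 * D\<^sup>2"
    using mult_left_mono[OF D2, of "16 * X * P\<^sup>2"] X by simp
  also have "\<dots> \<le> c * (16 * X * P\<^sup>2 * D\<^sup>2)"
    using mult_right_mono[OF \<open>1 \<le> c\<close>, of "16 * X * P\<^sup>2 * D\<^sup>2"] X by simp
  finally have aE: "a * E \<le> 16 * c * X * P\<^sup>2 * D\<^sup>2" by simp
  have "h * E * (h * a * E + (b\<^sup>2)\<^sup>2 * D\<^sup>2)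
      \<le> c * R * (8 * P\<^sup>2 * D) * (c * R * (2 * X) * (8 * P\<^sup>2 * D) + (4 * P\<^sup>2)\<^sup>2 * D\<^sup>2)"
    using nonneg assms(7,8) X a h E8 b2
    by (intro mult_mono add_mono power_mono mult_nonneg_nonneg add_nonneg_nonneg) auto
  also have "\<dots> = 128 * c * D\<^sup>2 * P ^ 4 * (c * R\<^sup>2 * X + R * P\<^sup>2 * D)"
    by (simp add: power2_eq_square power4_eq_xxxx algebra_simps)
  also have "\<dots> \<le> 128 * c * D\<^sup>2 * P ^ 4 * (c * X\<^sup>2 * D\<^sup>2 + c * X\<^sup>2 * D\<^sup>2)"
  proof (intro mult_left_mono add_mono)
    have "1 \<le> D\<^sup>2" using D2 assms(7) by linarith
    then have "c * X\<^sup>2 * 1 \<le> c * X\<^sup>2 * D\<^sup>2" using assms(8) by (intro mult_left_mono) auto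
    then show "c * R\<^sup>2 * X \<le> c * X\<^sup>2 * D\<^sup>2"
      unfolding R by (simp add: power2_eq_square mult.assoc)
    have "R * P\<^sup>2 * D \<le> R * (X * R) * D\<^sup>2"
      using P D2 nonneg X assms(7) by (intro mult_mono mult_left_mono mult_nonneg_nonneg) auto
    also have "R * (X * R) = X\<^sup>2" by (simp add: power2_eq_square flip: R)
    also have "X\<^sup>2 * D\<^sup>2 \<le> c * (X\<^sup>2 * D\<^sup>2)"
      using mult_right_mono[OF \<open>1 \<le> c\<close>, of "X\<^sup>2 * D\<^sup>2"] by simp
    finally show "R * P\<^sup>2 * D \<le> c * X\<^sup>2 * D\<^sup>2" by simp
  qed (use assms(8) in auto)
  also have "\<dots> = (16 * c * X * P\<^sup>2 * D\<^sup>2)\<^sup>2"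
    by (simp add: power2_eq_square power4_eq_xxxx algebra_simps)
  finally have "M\<^sup>2 \<le> (16 * c * X * P\<^sup>2 * D\<^sup>2)\<^sup>2" using M by linarith
  then have "M \<le> 16 * c * X * P\<^sup>2 * D\<^sup>2"
    by (rule power2_le_imp_le) (use X assms(8) in auto)
  then show ?thesis using aE by linarith
qed

lemma card_nonzero_integers_le:
  fixes L :: real
  assumes "1 \<le> L"
  shows "finite {h::int. h \<noteq> 0 \<and> \<bar>of_int h\<bar> \<le> L}"
    and "card {h::int. h \<noteq> 0 \<and> \<bar>of_int h\<bar> \<le> L} \<le> 3 * L"
proof -
  have sub: "{h::int. h \<noteq> 0 \<and> \<bar>of_int h\<bar> \<le> L} \<subseteq> {-\<lfloor>L\<rfloor>..\<lfloor>L\<rfloor>}"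
    by (auto simp: le_floor_iff minus_le_iff abs_le_iff)
  then show "finite {h::int. h \<noteq> 0 \<and> \<bar>of_int h\<bar> \<le> L}"
    by (rule finite_subset) simp
  have "card {h::int. h \<noteq> 0 \<and> \<bar>of_int h\<bar> \<le> L} \<le> card {-\<lfloor>L\<rfloor>..\<lfloor>L\<rfloor>}"
    using sub by (intro card_mono) auto
  then show "card {h::int. h \<noteq> 0 \<and> \<bar>of_int h\<bar> \<le> L} \<le> 3 * L"
    using assms by simp linarith
qed

section \<open>The mean value\<close>

text \<open>
  The exponents fit together as follows: \<open>P\<^sup>k = N\<^bsup>5/6\<^esup> = X\<^sup>2 R\<close> with \<open>R = N\<^bsup>1/6\<^esup>\<close> confines the shifts to
  \<open>\<bar>h\<bar> \<le> 2\<^bsup>k+1\<^esup> R\<close>, and \<open>P\<^sup>2 \<le> X R = N\<^bsup>1/2\<^esup>\<close> amounts to \<open>10 \<le> 3k\<close>. All integers whose divisors are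
  counted are at most \<open>2\<^bsup>k+1\<^esup> N\<close> in absolute value, and the divisor bound is used with exponent
  \<open>\<epsilon>/2\<close> because the number of divisors enters squared.
\<close>

lemma energy_cube_two_powers_le:
  fixes k :: nat and N \<epsilon> C :: real
  assumes k: "4 \<le> k" and N: "1 \<le> N" and "0 < \<epsilon>" and "1 \<le> C"
    and C: "\<And>n::int. n \<noteq> 0 \<Longrightarrow> card {d. d dvd n} \<le> C * \<bar>real_of_int n\<bar> powr (\<epsilon> / 2)"
  defines "X \<equiv> N powr (1 / 3)" and "P \<equiv> N powr (5 / 6 / real k)"
  shows "energy (\<lambda>(x, p). x ^ 3 + (\<lambda>(y, z). y ^ k + z ^ k) p) (dyadic X \<times> dyadic P \<times> dyadic P)
    \<le> 32 * 2 ^ (k + 3) * C\<^sup>2 * (2 ^ (k + 1)) powr \<epsilon> * (X * (P * P)) * N powr \<epsilon>"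
proof -
  define R where "R = N powr (1 / 6)"
  define u where "u = (\<lambda>(y :: int, z :: int). y ^ k + z ^ k)"
  define A where "A = dyadic X"
  define B where "B = dyadic P"
  define L where "L = 2 ^ (k + 1) * R"
  define H where "H = {h::int. h \<noteq> 0 \<and> \<bar>of_int h\<bar> \<le> L}"
  define D\<^sub>0 where "D\<^sub>0 = C * (2 ^ (k + 1) * N) powr (\<epsilon> / 2)"
  define D where "D = nat \<lfloor>D\<^sub>0\<rfloor>"
  have X1: "1 \<le> X" and P1: "1 \<le> P" and R1: "1 \<le> R"
    using N by (auto simp: X_def P_def R_def ge_one_powr_ge_zero)
  have RX: "R\<^sup>2 = X"
    using N by (simp add: R_def X_def powr_power)
  have Pk: "P ^ k = X\<^sup>2 * R"
    using N k by (simp add: P_def X_def R_def powr_power flip: powr_add)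
  have PkN: "P ^ k \<le> N"
    using N k powr_mono[of "5 / 6" 1 N] by (simp add: P_def powr_power)
  have PX: "P\<^sup>2 \<le> X * R"
  proof -
    have "5 / 6 / real k * 2 \<le> 1 / 2" using k by (simp add: field_simps)
    then have "N powr (5 / 6 / real k * 2) \<le> N powr (1 / 2)"
      using N by (intro powr_mono) auto
    then show ?thesis
      using N by (simp add: P_def X_def R_def powr_power flip: powr_add)
  qed
  have one: "(1::real) \<le> 2 ^ (k + 1)" by (rule two_realpow_ge_one)
  then have "1 \<le> 2 ^ (k + 1) * N" using mult_mono'[OF one N] by simp
  then have "1 \<le> (2 ^ (k + 1) * N) powr (\<epsilon> / 2)"
    using assms(3) by (intro ge_one_powr_ge_zero) auto
  then have D01: "1 \<le> D\<^sub>0"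
    using mult_mono'[OF \<open>1 \<le> C\<close>] by (fastforce simp: D\<^sub>0_def)
  then have D1: "1 \<le> real D"
    using le_nat_floor[of 1 D\<^sub>0] by (simp add: D_def)
  have DD: "real D \<le> D\<^sub>0"
    unfolding D_def using D01 by (intro of_nat_floor) simp
  have div: "card {d. d dvd n} \<le> D" if "n \<noteq> 0" "\<bar>real_of_int n\<bar> \<le> 2 ^ (k + 1) * P ^ k" for n :: int
  proof -
    have "\<bar>real_of_int n\<bar> \<le> 2 ^ (k + 1) * N"
      using that(2) PkN by (meson mult_left_mono order_trans zero_le_numeral zero_le_power)
    then have "C * \<bar>real_of_int n\<bar> powr (\<epsilon> / 2) \<le> D\<^sub>0"
      using assms(3,4) unfolding D\<^sub>0_def by (intro mult_left_mono powr_mono2) auto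
    then have "real (card {d. d dvd n}) \<le> D\<^sub>0" using C[OF that(1)] by linarith
    then show ?thesis unfolding D_def by (rule le_nat_floor)
  qed
  have posA: "0 < x" if "x \<in> A" for x
    using that X1 by (simp add: A_def dyadic_def)
  have posB: "0 < y" if "y \<in> B" for y
    using that P1 by (simp add: B_def dyadic_def)
  have Bpow: "0 \<le> real_of_int (y ^ k)" "real_of_int (y ^ k) \<le> 2 ^ k * P ^ k" if "y \<in> B" for y
  proof -
    show "0 \<le> real_of_int (y ^ k)" using posB[OF that] by simp
    have "real_of_int y ^ k \<le> (2 * P) ^ k"
      using that posB[OF that] by (intro power_mono) (auto simp: B_def dyadic_def)
    then show "real_of_int (y ^ k) \<le> 2 ^ k * P ^ k" by (simp add: power_mult_distrib)
  qed
  have uB: "\<bar>real_of_int (u p - u q)\<bar> \<le> 2 ^ (k + 1) * P ^ k" if pB: "p \<in> B \<times> B" and qB: "q \<in> B \<times> B" for p q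
  proof -
    obtain y z where p: "p = (y, z)" "y \<in> B" "z \<in> B" using pB by blast
    obtain y' z' where q: "q = (y', z')" "y' \<in> B" "z' \<in> B" using qB by blast
    have "real_of_int (u p - u q) = (of_int (y ^ k) + of_int (z ^ k)) - (of_int (y' ^ k) + of_int (z' ^ k))"
      by (simp add: u_def p q)
    moreover have "2 ^ (k + 1) * P ^ k = 2 ^ k * P ^ k + 2 ^ k * P ^ k" by simp
    ultimately show ?thesis
      using Bpow[OF p(2)] Bpow[OF p(3)] Bpow[OF q(2)] Bpow[OF q(3)] by linarith
  qed
  have finA: "finite A" and finB: "finite B" by (auto simp: A_def B_def finite_dyadic)
  have L1: "1 \<le> L" unfolding L_def using mult_mono'[OF one R1] by simp
  have finH: "finite H" and cardH: "card H \<le> 3 * L"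
    unfolding H_def using card_nonzero_integers_le[OF L1] by auto
  have E: "energy u (B \<times> B) \<le> (card B)\<^sup>2 * (1 + D)"
    unfolding u_def
  proof (rule energy_two_powers_le[OF finB posB])
    fix a b assume ab: "a \<in> B" "b \<in> B" "a \<noteq> b"
    then have "a ^ k - b ^ k \<noteq> 0"
      using posB[of a] posB[of b] k by (simp add: power_eq_iff_eq_base)
    moreover have "\<bar>real_of_int (a ^ k - b ^ k)\<bar> \<le> 2 ^ (k + 1) * P ^ k"
      using uB[of "(a, a)" "(b, a)"] ab by (simp add: u_def)
    ultimately show "card {d. d dvd a ^ k - b ^ k} \<le> D" by (rule div)
  qed (use k in auto)
  have "\<exists>M. energy (\<lambda>(x, p). x ^ 3 + u p) (A \<times> (B \<times> B)) \<le> card A * energy u (B \<times> B) + M \<and>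
    M\<^sup>2 \<le> card H * energy u (B \<times> B) *
      (card H * card A * energy u (B \<times> B) + (card (B \<times> B))\<^sup>2 * D\<^sup>2)"
  proof (rule energy_cube_plus_le[OF finA _ finH posA])
    show "finite (B \<times> B)" using finB by simp
    show "0 \<notin> H" by (simp add: H_def)
    show "card {d. d dvd u p - u q} \<le> D" if "p \<in> B \<times> B" "q \<in> B \<times> B" "u p \<noteq> u q" for p q
      using that uB by (intro div) auto
    show "y - x \<in> H" if "x \<in> A" "y \<in> A" "p \<in> B \<times> B" "q \<in> B \<times> B" "x \<noteq> y"
      "x ^ 3 + u p = y ^ 3 + u q" for x y p q
    proof -
      have "y ^ 3 - x ^ 3 = u p - u q" using that(6) by linarith
      then have "\<bar>real_of_int (y ^ 3 - x ^ 3)\<bar> \<le> X\<^sup>2 * L"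
        using uB[OF that(3,4)] by (simp only: L_def Pk mult_ac)
      then have "\<bar>real_of_int (y - x)\<bar> \<le> L"
        using that(1,2) X1 by (intro cube_gap_bounds_shift[of x X y]) (auto simp: A_def)
      then show ?thesis using that(5) by (simp add: H_def)
    qed
  qed
  then obtain M where M: "energy (\<lambda>(x, p). x ^ 3 + u p) (A \<times> (B \<times> B)) \<le> card A * energy u (B \<times> B) + M"
    "M\<^sup>2 \<le> card H * energy u (B \<times> B) *
      (card H * card A * energy u (B \<times> B) + (card (B \<times> B))\<^sup>2 * D\<^sup>2)"
    by blast
  have M1: "real (energy (\<lambda>(x, p). x ^ 3 + u p) (A \<times> (B \<times> B)))
      \<le> real (card A) * real (energy u (B \<times> B)) + real M"
    using M(1) by (simp flip: of_nat_mult of_nat_add)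
  have "real (M\<^sup>2) \<le> real (card H * energy u (B \<times> B) *
      (card H * card A * energy u (B \<times> B) + (card (B \<times> B))\<^sup>2 * D\<^sup>2))"
    using M(2) by (simp only: of_nat_le_iff)
  then have M2: "(real M)\<^sup>2 \<le> real (card H) * real (energy u (B \<times> B)) *
      (real (card H) * real (card A) * real (energy u (B \<times> B)) + ((real (card B))\<^sup>2)\<^sup>2 * (real D)\<^sup>2)"
    by (simp add: card_cartesian_product power2_eq_square)
  have "real (energy u (B \<times> B)) \<le> real ((card B)\<^sup>2 * (1 + D))"
    using E by (simp only: of_nat_le_iff)
  then have E': "real (energy u (B \<times> B)) \<le> (real (card B))\<^sup>2 * (1 + real D)"
    by (simp add: distrib_left)
  have cH: "real (card H) \<le> 2 ^ (k + 3) * R"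
    using cardH mult_pos_pos[of "2 ^ k" R] R1 by (simp add: L_def power_add)
  have "real (card A) * real (energy u (B \<times> B)) + real M \<le> 32 * 2 ^ (k + 3) * X * P\<^sup>2 * (real D)\<^sup>2"
    using P1 R1 X1 D1 RX PX cH E' M2 card_dyadic_le[OF X1] card_dyadic_le[OF P1]
    by (intro shifted_cube_bound_evaluation[where b = "real (card B)" and h = "real (card H)" and R = R])
       (auto simp: A_def B_def)
  also have "\<dots> \<le> 32 * 2 ^ (k + 3) * X * P\<^sup>2 * D\<^sub>0\<^sup>2"
    using DD X1 by (intro mult_left_mono power_mono) auto
  also have "D\<^sub>0\<^sup>2 = C\<^sup>2 * ((2 ^ (k + 1)) powr \<epsilon> * N powr \<epsilon>)"
  proof -
    have "((2 ^ (k + 1) * N) powr (\<epsilon> / 2))\<^sup>2 = (2 ^ (k + 1) * N) powr \<epsilon>"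
      using N by (simp add: powr_power)
    also have "\<dots> = (2 ^ (k + 1)) powr \<epsilon> * N powr \<epsilon>"
      by (rule powr_mult)
    finally show ?thesis by (simp only: D\<^sub>0_def power_mult_distrib)
  qed
  finally show ?thesis
    using M1 unfolding A_def B_def u_def by (simp add: power2_eq_square mult_ac)
qed

theorem theorem2p1:
  fixes k :: nat
  assumes "k \<ge> 4"
  shows "admissible_exponents [(3, 1), (k, 5 / 6), (k, 5 / 6)]"
  unfolding admissible_exponents_def
proof (intro conjI allI impI)
  show "\<forall>(k, l)\<in>set [(3, 1), (k, 5 / 6), (k, 5 / 6 :: real)]. 1 \<le> k \<and> 0 < l \<and> l \<le> 1"
    using assms by auto
next
  fix \<epsilon> :: real assume \<epsilon>: "0 < \<epsilon>"
  then obtain C where C: "1 \<le> C"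
    "\<And>n::int. n \<noteq> 0 \<Longrightarrow> card {d. d dvd n} \<le> C * \<bar>real_of_int n\<bar> powr (\<epsilon> / 2)"
    using divisor_bound_int[of "\<epsilon> / 2"] by auto
  let ?C = "32 * 2 ^ (k + 3) * C\<^sup>2 * (2 ^ (k + 1)) powr \<epsilon>"
  have "integral {0..1} (\<lambda>\<alpha>. (cmod (\<Prod>p\<leftarrow>[(3, 1), (k, 5 / 6), (k, 5 / 6)].
      weyl_sum (fst p) \<alpha> (range_param N p)))\<^sup>2)
    \<le> ?C * (\<Prod>p\<leftarrow>[(3, 1), (k, 5 / 6), (k, 5 / 6)]. range_param N p) * N powr \<epsilon>"
    if "1 \<le> N" for N
    using energy_cube_two_powers_le[OF assms that \<epsilon> C]
      integral_weyl_product_eq_energy[of 3 "N powr (1 / 3)" k "N powr (5 / 6 / real k)"]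
    by (simp add: range_param_def)
  moreover have "0 < ?C" using C(1) by simp
  ultimately show "\<exists>C>0. \<forall>N\<ge>1. integral {0..1} (\<lambda>\<alpha>. (cmod (\<Prod>p\<leftarrow>[(3, 1), (k, 5 / 6), (k, 5 / 6)].
      weyl_sum (fst p) \<alpha> (range_param N p)))\<^sup>2)
    \<le> C * (\<Prod>p\<leftarrow>[(3, 1), (k, 5 / 6), (k, 5 / 6)]. range_param N p) * N powr \<epsilon>"
    by blast
qed

end
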